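(* Let $I$ and $K$ be finite sets, let $g_i\in\mathbb{Z}[X]$, $i\in I$, be distinct polynomials irreducible in $\mathbb{Z}[X]$, and let $p_k$, $k\in K$, be distinct prime integers. Suppose that $d_K=\prod_{k\in K}p_k$ is coprime to the content of $g_I=\prod_{i\in I}g_i$ and that $$f(X)=\frac{\prod_{i\in I}g_i(X)}{\prod_{k\in K}p_k}=\frac{g_I(X)}{d_K}$$ is an image primitive integer-valued polynomial. Let $\mathcal{G}=\{g_i\}_{i\in I}$ and $\mathcal{P}=\{p_k\}_{k\in K}$. Let $\mathcal{J}=\{J_k\}_{k\in K}$ be a family of minimal $\mathcal{P}$-coverings for $\mathcal{G}$ which is partitionable by means of a partition $K=\dot\bigcup_{j\in\mathcal{I}}K_j$, so that the sets $I_j=I_{\mathcal{J},K_j}=\bigcup_{k\in K_j}J_k$, $j\in\mathcal{I}$, are pairwise disjoint, and suppose that for each $j\in\mathcal{I}$ the integer-valued polynomial $g_{I_j}(X)/d_{K_j}$ satisfies the irreducibility conditions (stated in the context) relative to $(I_j,K_j)$. Put $I'=\bigcup_{j\in\mathcal{I}}I_j$. Then $$f(X)=g_{I\setminus I'}(X)\cdot\prod_{j\in\mathcal{I}}\frac{g_{I_j}(X)}{d_{K_j}},\qquad g_{I\setminus I'}(X)=\prod_{i\in I\setminus I'}g_i(X),$$ is a factorization of $f(X)$ into irreducibles in $\mathrm{Int}(\mathbb{Z})$, whose irreducible factors are the $g_i$ for $i\in I\setminus I'$ and the $g_{I_j}/d_{K_j}$ for $j\in\mathcal{I}$; it has $\#(I\setminus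 I')+\#\mathcal{I}$ irreducible factors. Conversely, every factorization of $f(X)$ into irreducibles in $\mathrm{Int}(\mathbb{Z})$ is (up to order and units) obtained in this way from some such $\mathcal{J}$ and partition of $K$.
   Context: $\mathrm{Int}(\mathbb{Z})=\{f\in\mathbb{Q}[X] : f(\mathbb{Z})\subset\mathbb{Z}\}$ is the ring of integer-valued polynomials; its units are $\pm1$. Factorizations are considered essentially the same if they agree up to reordering and multiplication of factors by units. For $f\in\mathrm{Int}(\mathbb{Z})$, the fixed divisor $d(f)$ is the g.c.d. of $\{f(n): n\in\mathbb{Z}\}$, and $f$ is image primitive if $d(f)=1$. The content of a polynomial in $\mathbb{Z}[X]$ is the g.c.d. of its coefficients. For $g\in\mathbb{Z}[X]$ and a prime $p$, $C_{p,g}=\{j\in\{0,\ldots,p-1\} : p\mid g(j)\}$. Given a family $\mathcal{G}=\{g_i\}_{i\in I}$ of polynomials in $\mathbb{Z}[X]$, a $p$-covering for $\mathcal{G}$ is a subset $J\subseteq I$ such that $\bigcup_{i\in J}C_{p,g_i}=\{0,\ldots,p-1\}$ (with the convention that $C_{p,g_i}\neq\emptyset$ for each $i\in J$); it is minimal if no proper subset of $J$ is a $p$-covering. Given a set $\mathcal{P}=\{p_k\}_{k\in K}$ of distinct primes, a family of minimal $\mathcal{P}$-coverings for $\mathcal{G}$ is a family $\mathcal{J}=\{J_k\}_{k\in K}$ such that for each $k\in K$, $J_k\subseteq I$ is a minimal $p_k$-covering for $\mathcal{G}$. For $J\subseteq I$ set $g_J=\prod_{i\in J}g_i$; for $T\subseteq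 K$ set $d_T=\prod_{k\in T}p_k$ and $I_{\mathcal{J},T}=\bigcup_{k\in T}J_k$. The family $\mathcal{J}$ is partitionable if there is a partition $K=\dot\bigcup_{j\in\mathcal{I}}K_j$ into nonempty sets such that the sets $I_{\mathcal{J},K_j}$, $j\in\mathcal{I}$, are pairwise disjoint (the partition of $K$ with a single block is allowed). Irreducibility conditions relative to $(I_j,K_j)$: for every family $\mathcal{J}'=\{J'_k\}_{k\in K_j}$ of minimal $\{p_k\}_{k\in K_j}$-coverings for $\{g_i\}_{i\in I_j}$ (so $J'_k\subseteq I_j$), one has (i) $I_j=\bigcup_{k\in K_j}J'_k$, and (ii) there is no partition of $K_j$ into two disjoint nonempty subsets $A,B$ such that $\bigcup_{k\in A}J'_k$ and $\bigcup_{k\in B}J'_k$ are disjoint. *)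

theory Defs
  imports
    "HOL-Algebra.Divisibility"
    "HOL-Algebra.Ring"
    "HOL-Computational_Algebra.Polynomial_Factorial"
    "HOL-Library.Disjoint_Sets"
begin

definition int_valued :: "rat poly ring" where
  "int_valued = \<lparr>carrier = {f. \<forall>n::int. poly f (of_int n) \<in> \<int>},
     mult = (*), one = 1, zero = 0, add = (+)\<rparr>"

lemma domain_int_valued: "domain int_valued"
proof (intro domain.intro domain_axioms.intro cringI abelian_groupI comm_monoidI)
  fix f :: "rat poly" assume "f \<in> carrier int_valued"
  then show "\<exists>h\<in>carrier int_valued. h \<oplus>\<^bsub>int_valued\<^esub> f = \<zero>\<^bsub>int_valued\<^esub>"
    by (intro bexI[of _ "- f"]) (auto simp: int_valued_def)
qed (auto simp: int_valued_def algebra_simps)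

lemma Units_int_valued: "Units int_valued = {1, -1}"
proof
  show "Units int_valued \<subseteq> {1, -1}"
  proof
    fix f assume "f \<in> Units int_valued"
    then obtain h where h: "h * f = 1"
        and f_int: "\<forall>n::int. poly f (of_int n) \<in> \<int>" and h_int: "\<forall>n::int. poly h (of_int n) \<in> \<int>"
      by (auto simp: Units_def int_valued_def)
    have "f dvd 1" using h by (metis dvd_triv_right)
    then obtain c where c: "f = [:c:]" by (auto elim: is_unit_polyE)
    from f_int[rule_format, of 0] h_int[rule_format, of 0] c obtain a b :: int
      where ab: "c = of_int a" "poly h 0 = of_int b"
      by (auto elim!: Ints_cases)
    have "poly h 0 * c = 1" using arg_cong[OF h, of "\<lambda>q. poly q 0"] c by (simp add: mult.commute)
    then have "b * a = 1" unfolding ab by (metis of_int_1 of_int_eq_iff of_int_mult)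
    then have "a = 1 \<or> a = -1" by (simp add: zmult_eq_1_iff) auto
    then show "f \<in> {1, -1}" using c ab(1) by (auto simp: one_pCons)
  qed
  show "{1, -1} \<subseteq> Units int_valued"
    by (auto simp: Units_def int_valued_def intro: exI[of _ "-1"])
qed

text \<open>The value set is represented by its integer elements; this is the whole value set whenever
  \<^term>\<open>f \<in> carrier int_valued\<close>.\<close>

definition fixed_divisor :: "rat poly \<Rightarrow> int" where
  "fixed_divisor f = Gcd {m. \<exists>n::int. poly f (of_int n) = of_int m}"

definition image_primitive :: "rat poly \<Rightarrow> bool" where
  "image_primitive f \<longleftrightarrow> f \<in> carrier int_valued \<and> fixed_divisor f = 1"

definition roots_mod :: "int \<Rightarrow> int poly \<Rightarrow> int set" where
  "roots_mod q h = {j \<in> {0..q - 1}. q dvd poly h j}"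

definition covering :: "int \<Rightarrow> ('i \<Rightarrow> int poly) \<Rightarrow> 'i set \<Rightarrow> 'i set \<Rightarrow> bool" where
  "covering q g I J \<longleftrightarrow> J \<subseteq> I \<and> (\<forall>i\<in>J. roots_mod q (g i) \<noteq> {}) \<and>
     (\<Union>i\<in>J. roots_mod q (g i)) = {0..q - 1}"

definition minimal_covering :: "int \<Rightarrow> ('i \<Rightarrow> int poly) \<Rightarrow> 'i set \<Rightarrow> 'i set \<Rightarrow> bool" where
  "minimal_covering q g I J \<longleftrightarrow> covering q g I J \<and> (\<forall>J'. J' \<subset> J \<longrightarrow> \<not> covering q g I J')"

text \<open>Only the values of \<^term>\<open>J\<close> on \<^term>\<open>K\<close> are relevant.\<close>

definition minimal_coverings ::
  "('k \<Rightarrow> int) \<Rightarrow> ('i \<Rightarrow> int poly) \<Rightarrow> 'i set \<Rightarrow> 'k set \<Rightarrow> ('k \<Rightarrow> 'i set) \<Rightarrow> bool" where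
  "minimal_coverings p g I K J \<longleftrightarrow> (\<forall>k\<in>K. minimal_covering (p k) g I (J k))"

definition quot_poly :: "('k \<Rightarrow> int) \<Rightarrow> ('i \<Rightarrow> int poly) \<Rightarrow> 'i set \<Rightarrow> 'k set \<Rightarrow> rat poly" where
  "quot_poly p g S T = smult (1 / of_int (\<Prod>k\<in>T. p k)) (map_poly of_int (\<Prod>i\<in>S. g i))"

text \<open>A partition of \<^term>\<open>K\<close> is given by its set of blocks \<^term>\<open>\<K>\<close>, which serves as its own
  index set; the blocks are nonempty by the definition of \<^const>\<open>partition_on\<close>.\<close>

definition partitionable_by :: "'k set \<Rightarrow> ('k \<Rightarrow> 'i set) \<Rightarrow> 'k set set \<Rightarrow> bool" where
  "partitionable_by K J \<K> \<longleftrightarrow>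
     partition_on K \<K> \<and> disjoint_family_on (\<lambda>T. \<Union>k\<in>T. J k) \<K>"

definition irreducibility_conditions ::
  "('k \<Rightarrow> int) \<Rightarrow> ('i \<Rightarrow> int poly) \<Rightarrow> 'i set \<Rightarrow> 'k set \<Rightarrow> bool" where
  "irreducibility_conditions p g S T \<longleftrightarrow>
     (\<forall>J'. minimal_coverings p g S T J' \<longrightarrow>
        S = (\<Union>k\<in>T. J' k) \<and>
        \<not> (\<exists>A B. A \<noteq> {} \<and> B \<noteq> {} \<and> A \<inter> B = {} \<and> A \<union> B = T \<and>
             (\<Union>k\<in>A. J' k) \<inter> (\<Union>k\<in>B. J' k) = {}))"

definition admissible ::
  "('k \<Rightarrow> int) \<Rightarrow> ('i \<Rightarrow> int poly) \<Rightarrow> 'i set \<Rightarrow> 'k set \<Rightarrow> ('k \<Rightarrow> 'i set) \<Rightarrow> 'k set set \<Rightarrow> bool" where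
  "admissible p g I K J \<K> \<longleftrightarrow>
     minimal_coverings p g I K J \<and> partitionable_by K J \<K> \<and>
     (\<forall>T\<in>\<K>. irreducibility_conditions p g (\<Union>k\<in>T. J k) T)"

definition uncovered :: "'i set \<Rightarrow> ('k \<Rightarrow> 'i set) \<Rightarrow> 'k set set \<Rightarrow> 'i set" where
  "uncovered I J \<K> = I - (\<Union>T\<in>\<K>. \<Union>k\<in>T. J k)"

definition associated_factors ::
  "('k \<Rightarrow> int) \<Rightarrow> ('i \<Rightarrow> int poly) \<Rightarrow> 'i set \<Rightarrow> ('k \<Rightarrow> 'i set) \<Rightarrow> 'k set set \<Rightarrow> rat poly multiset" where
  "associated_factors p g I J \<K> =
     image_mset (\<lambda>i. map_poly of_int (g i)) (mset_set (uncovered I J \<K>)) +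
     image_mset (\<lambda>T. quot_poly p g (\<Union>k\<in>T. J k) T) (mset_set \<K>)"

end

theory Submission
  imports Defs
begin

text \<open>By unique factorization in \<open>\<int>[X]\<close> and image primitivity, every factor of
  \<open>g\<^sub>A / d\<^sub>S\<close> in \<open>Int(\<int>)\<close> is, up to sign, \<open>g\<^sub>B / d\<^sub>T\<close> for some \<open>B \<subseteq> A\<close> and \<open>T \<subseteq> S\<close>, and the
  complementary factor is \<open>g\<^bsub>A - B\<^esub> / d\<^bsub>S - T\<^esub>\<close>. Such a quotient is integer-valued iff \<open>B\<close> contains a
  minimal \<open>p\<^sub>k\<close>-covering for each \<open>k \<in> T\<close>. Hence a factorization of \<open>g\<^sub>A / d\<^sub>S\<close> is a simultaneous
  partition of \<open>A\<close> and \<open>S\<close> into parts compatible with coverings, and irreducibility says that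
  no choice of minimal coverings allows a proper such partition.\<close>

section \<open>Unique factorization and integer polynomials\<close>

text \<open>Each prime \<open>h i\<close> divides \<open>x\<close> or \<open>y\<close>; cancelling
  it and inducting collects in \<open>A\<close> the indices that go to \<open>x\<close>. The
  constant \<open>c\<close> absorbs what the primes do not govern: integers from cleared
  denominators, or just \<open>1\<close> for a product of prime numbers.\<close>

lemma prime_elem_prod_split:
  fixes h :: "'i \<Rightarrow> 'a::idom"
  assumes "finite I" "\<And>i. i \<in> I \<Longrightarrow> prime_elem (h i)" "x * y = c * prod h I"
  shows "\<exists>A\<subseteq>I. \<exists>c1 c2. c1 * c2 = c \<and> x = c1 * prod h A \<and> y = c2 * prod h (I - A)"
  using assms
proof (induction I arbitrary: x y rule: finite_induct)
  case empty
  then show ?case by auto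
next
  case (insert i I)
  have i: "h i \<noteq> 0" "prime_elem (h i)" using insert.prems(1)[of i] by auto
  have eq: "x * y = h i * (c * prod h I)"
    using insert by (simp add: algebra_simps)
  then have "h i dvd x \<or> h i dvd y" using i(2) by (metis dvd_triv_left prime_elem_dvd_multD)
  then show ?case
  proof
    assume "h i dvd x"
    then obtain x' where x: "x = h i * x'" by (elim dvdE)
    then have "x' * y = c * prod h I" using eq i(1) by (simp add: mult.assoc)
    then obtain A c1 c2 where A: "A \<subseteq> I" "c1 * c2 = c" "x' = c1 * prod h A" "y = c2 * prod h (I - A)"
      using insert by blast
    have "i \<notin> A" "finite A" using A(1) insert.hyps finite_subset by auto
    moreover have "insert i I - insert i A = I - A" using insert.hyps by auto
    ultimately have "insert i A \<subseteq> insert i I" "c1 * c2 = c" "x = c1 * prod h (insert i A)"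
      "y = c2 * prod h (insert i I - insert i A)"
      using A x by (auto simp: algebra_simps)
    then show ?thesis by blast
  next
    assume "h i dvd y"
    then obtain y' where y: "y = h i * y'" by (elim dvdE)
    then have "x * y' = c * prod h I" using eq i(1) by (simp add: mult.left_commute)
    then obtain A c1 c2 where A: "A \<subseteq> I" "c1 * c2 = c" "x = c1 * prod h A" "y' = c2 * prod h (I - A)"
      using insert by blast
    have "insert i I - A = insert i (I - A)" using A(1) insert.hyps by auto
    then have "A \<subseteq> insert i I" "c1 * c2 = c" "x = c1 * prod h A" "y = c2 * prod h (insert i I - A)"
      using A y insert.hyps by (auto simp: algebra_simps)
    then show ?thesis by blast
  qed
qed

lemma map_poly_of_int_mult:
  "map_poly of_int (a * b :: int poly) = (map_poly of_int a * map_poly of_int b :: 'a::{comm_ring_1} poly)"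
  by (rule poly_eqI) (simp add: coeff_map_poly coeff_mult)

lemma map_poly_of_int_prod:
  "map_poly of_int (\<Prod>i\<in>A. h i :: int poly) = (\<Prod>i\<in>A. map_poly of_int (h i) :: 'a::{comm_ring_1} poly)"
  by (induction A rule: infinite_finite_induct) (simp_all add: map_poly_of_int_mult)

lemma poly_map_poly_of_int:
  "poly (map_poly of_int a) (of_int n) = (of_int (poly a n) :: 'a::comm_ring_1)"
  by (induction a) (simp_all add: map_poly_pCons)

lemma map_poly_of_int_eq_iff [simp]:
  "(map_poly of_int a :: 'a::ring_char_0 poly) = map_poly of_int b \<longleftrightarrow> a = b"
  by (auto simp: poly_eq_iff coeff_map_poly)

lemma rat_poly_clear_denominators:
  fixes a :: "rat poly"
  obtains m :: int and h :: "int poly" where "m > 0" "smult (of_int m) a = map_poly of_int h"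
proof -
  have "\<exists>m h. m > 0 \<and> smult (of_int m) a = map_poly of_int h"
  proof (induction a)
    case 0
    show ?case by (intro exI[of _ 1] exI[of _ 0]) simp
  next
    case (pCons c a)
    then obtain m h where IH: "m > 0" "smult (of_int m) a = map_poly of_int h" by blast
    obtain u v where c: "c = of_int u / of_int v" "v > 0"
      using quotient_of_div[of c] quotient_of_denom_pos[of c] by (cases "quotient_of c") auto
    have "smult (of_int (m * v)) (pCons c a) = map_poly of_int (pCons (m * u) (smult v h))"
      using c(2) by (simp add: c(1) map_poly_pCons map_poly_smult mult.commute flip: IH(2))
    then show ?case using IH(1) c(2) by (metis mult_pos_pos)
  qed
  then show ?thesis using that by blast
qed

lemma diff_dvd_poly_diff:
  fixes h :: "'a::comm_ring_1 poly"
  shows "x - y dvd poly h x - poly h y"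
proof (induction h)
  case (pCons c h)
  have "poly (pCons c h) x - poly (pCons c h) y = x * (poly h x - poly h y) + (x - y) * poly h y"
    by (simp add: algebra_simps)
  then show ?case using pCons.IH by (metis dvd_add dvd_mult dvd_triv_left)
qed simp

text \<open>Allows \<open>roots_mod\<close> to look only at the representatives
  \<open>{0..q - 1}\<close> while divisibility is tested at every integer.\<close>

lemma dvd_poly_mod_iff:
  fixes h :: "int poly"
  shows "q dvd poly h (n mod q) \<longleftrightarrow> q dvd poly h n"
proof -
  have "q dvd n - n mod q" by (simp add: minus_mod_eq_mult_div)
  then have "q dvd poly h n - poly h (n mod q)"
    using diff_dvd_poly_diff dvd_trans by blast
  then show ?thesis using dvd_add_right_iff[of q "poly h n - poly h (n mod q)" "poly h (n mod q)"] by simp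
qed

lemma mult_eq_prod_primes_split:
  fixes p :: "'k \<Rightarrow> int"
  assumes "finite K" "\<And>k. k \<in> K \<Longrightarrow> Factorial_Ring.prime (p k)" "v > 0" "v * w = prod p K"
  obtains S where "S \<subseteq> K" "v = prod p S" "w = prod p (K - S)"
proof -
  have "prime_elem (p k)" if "k \<in> K" for k using assms(2)[OF that] by (rule prime_imp_prime_elem)
  then have "\<exists>S\<subseteq>K. \<exists>c1 c2. c1 * c2 = 1 \<and> v = c1 * prod p S \<and> w = c2 * prod p (K - S)"
    using assms(1,4) by (intro prime_elem_prod_split) auto
  then obtain S c1 c2 where S: "S \<subseteq> K" "c1 * c2 = 1" "v = c1 * prod p S" "w = c2 * prod p (K - S)"
    by blast
  have "prod p S > 0" using assms(2) S(1) prime_gt_0_int by (intro prod_pos) blast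
  \<comment> \<open>The splitting determines \<open>v\<close> only up to a unit of the integers;
    positivity of \<open>v\<close> and of the primes excludes the sign \<open>-1\<close>.\<close>
  then have "c1 = 1" using S(2,3) assms(3) by (auto simp: zmult_eq_1_iff)
  with S(2-4) have "v = prod p S" "w = prod p (K - S)" by simp_all
  with S(1) show ?thesis by (rule that)
qed

lemma prod_primes_dvd:
  fixes p :: "'k \<Rightarrow> int"
  assumes "finite T" "inj_on p T" "\<And>k. k \<in> T \<Longrightarrow> Factorial_Ring.prime (p k)"
    "\<And>k. k \<in> T \<Longrightarrow> p k dvd x"
  shows "prod p T dvd x"
  using assms
proof (induction T rule: finite_induct)
  case (insert k T)
  have "coprime (p k) (prod p T)"
    using insert.prems insert.hyps by (intro prod_coprime_right primes_coprime) (auto simp: inj_on_def)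
  then show ?case using insert by (simp add: divides_mult)
qed simp

section \<open>Irreducibility and image primitivity in the ring of integer-valued
  polynomials\<close>

lemma int_valued_simps [simp]:
  "f \<in> carrier int_valued \<longleftrightarrow> (\<forall>n::int. poly f (of_int n) \<in> \<int>)"
  "mult int_valued = (*)" "\<one>\<^bsub>int_valued\<^esub> = 1"
  by (simp_all add: int_valued_def)

text \<open>The algebraic definition speaks of proper divisors. Cancellation of \<open>h\<close>
  translates it into the usual condition on products of two factors: when \<open>a * b = h\<close>,
  the factor \<open>a\<close> is proper exactly if \<open>b\<close> is not a unit.\<close>

lemma irreducible_int_valued_iff:
  assumes "h \<in> carrier int_valued" "h \<noteq> 0"
  shows "Divisibility.irreducible int_valued h \<longleftrightarrow>
    h \<notin> {1, -1} \<and> (\<forall>a\<in>carrier int_valued. \<forall>b\<in>carrier int_valued. a * b = h \<longrightarrow> a \<in> {1, -1} \<or> b \<in> {1, -1})"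
    (is "_ \<longleftrightarrow> ?R")
proof
  assume irr: "Divisibility.irreducible int_valued h"
  have "a \<in> {1, -1} \<or> b \<in> {1, -1}"
    if ab: "a \<in> carrier int_valued" "b \<in> carrier int_valued" "a * b = h" for a b
  proof (cases "h divides\<^bsub>int_valued\<^esub> a")
    case True
    then obtain c where c: "c \<in> carrier int_valued" "a = h * c" by (auto simp: factor_def)
    then have "h * (c * b) = h * 1" using ab(3) by (simp only: mult.assoc mult_1_right)
    then have "c * b = 1" using assms(2) mult_left_cancel by blast
    then have "b \<in> Units int_valued" using ab(2) c(1) by (auto simp: Units_def mult.commute)
    then show ?thesis by (simp add: Units_int_valued)
  next
    case False
    have "a divides\<^bsub>int_valued\<^esub> h" using ab by (auto simp: factor_def)
    then have "a \<in> Units int_valued"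
      using irr ab(1) False unfolding Divisibility.irreducible_def properfactor_def by blast
    then show ?thesis by (simp add: Units_int_valued)
  qed
  then show ?R using irr unfolding Divisibility.irreducible_def Units_int_valued by blast
next
  assume R: ?R
  have "b \<in> Units int_valued"
    if b: "b \<in> carrier int_valued" "properfactor int_valued b h" for b
  proof -
    obtain c where c: "c \<in> carrier int_valued" "h = b * c"
      using b(2) by (auto simp: properfactor_def factor_def)
    have "c \<notin> {1, -1}"
    proof
      assume "c \<in> {1, -1}"
      then have "c * c = 1" by auto
      then have "b = h * c" using c(2) by (simp add: mult.assoc)
      then show False using b(2) c(1) by (auto simp: properfactor_def factor_def)
    qed
    then show ?thesis using R b(1) c unfolding Units_int_valued by blast
  qed
  then show "Divisibility.irreducible int_valued h"
    using R unfolding Divisibility.irreducible_def Units_int_valued by blast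
qed

lemma smult_sign_associated:
  assumes "h \<in> carrier int_valued" "s \<in> {1, -1 :: rat}"
  shows "smult s h \<sim>\<^bsub>int_valued\<^esub> h"
proof -
  have "[:s:] \<in> carrier int_valued" using assms(2) by auto
  moreover have "smult s h = h * [:s:]" "h = smult s h * [:s:]" using assms(2) by auto
  ultimately show ?thesis unfolding associated_def factor_def int_valued_simps(2) by blast
qed

text \<open>The constant \<open>[:s:]\<close> is its own inverse. This passes irreducibility from an
  entry of a factorization to its sign-normalized quotient.\<close>

lemma irreducible_smult_sign:
  assumes "Divisibility.irreducible int_valued (smult s h)" "h \<in> carrier int_valued" "s \<in> {1, -1 :: rat}"
  shows "Divisibility.irreducible int_valued h"
proof -
  interpret domain int_valued by (rule domain_int_valued)
  have "[:s:] \<in> Units int_valued" using assms(3) by (auto simp: Units_int_valued one_pCons)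
  moreover have "smult s h \<in> carrier int_valued" "[:s:] \<in> carrier int_valued" using assms(2,3) by auto
  ultimately have "Divisibility.irreducible int_valued (smult s h \<otimes>\<^bsub>int_valued\<^esub> [:s:])"
    using assms(1) by (intro irreducible_prod_rI)
  moreover have "smult s h \<otimes>\<^bsub>int_valued\<^esub> [:s:] = h" using assms(3) by auto
  ultimately show ?thesis by simp
qed

lemma int_valued_mult: "a \<in> carrier int_valued \<Longrightarrow> b \<in> carrier int_valued \<Longrightarrow> a * b \<in> carrier int_valued"
  by simp

text \<open>Such a \<open>d\<close> divides every value, hence the fixed divisor \<open>1\<close>.
  All later uses of image primitivity as a divisibility obstruction go through this form.\<close>

lemma image_primitive_imp_unit:
  assumes "image_primitive f" "\<And>n::int. \<exists>m::int. poly f (of_int n) = of_int (d * m)"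
  shows "is_unit (d::int)"
proof -
  have "d dvd Gcd {m. \<exists>n::int. poly f (of_int n) = of_int m}"
  proof (rule Gcd_greatest)
    fix m assume "m \<in> {m. \<exists>n::int. poly f (of_int n) = of_int m}"
    then obtain n :: int where n: "poly f (of_int n) = of_int m" by auto
    obtain m' where "poly f (of_int n) = of_int (d * m')" using assms(2) by blast
    then have "m = d * m'" using n by (metis of_int_eq_iff)
    then show "d dvd m" by simp
  qed
  then show ?thesis using assms(1) by (simp add: image_primitive_def fixed_divisor_def)
qed

text \<open>A common divisor of the values of \<open>a\<close> also divides the values of
  \<open>a * b\<close>. It is therefore a unit, and \<open>Gcd\<close> is never negative.\<close>

lemma image_primitive_factor:
  assumes "a \<in> carrier int_valued" "b \<in> carrier int_valued" "image_primitive (a * b)"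
  shows "image_primitive a"
proof -
  let ?d = "fixed_divisor a"
  have "\<exists>m. poly (a * b) (of_int n) = of_int (?d * m)" for n :: int
  proof -
    obtain k l where kl: "poly a (of_int n) = of_int k" "poly b (of_int n) = of_int l"
      using assms(1,2) by (metis int_valued_simps(1) Ints_cases)
    have "?d dvd k" using kl(1) unfolding fixed_divisor_def by (intro Gcd_dvd) auto
    then obtain e where "k = ?d * e" by blast
    then show ?thesis using kl by (intro exI[of _ "e * l"]) simp
  qed
  then have "is_unit ?d" by (rule image_primitive_imp_unit[OF assms(3)])
  moreover have "?d \<ge> 0" by (simp add: fixed_divisor_def)
  ultimately show ?thesis using assms(1) by (simp add: image_primitive_def zdvd1_eq)
qed

text \<open>Write the scalar as \<open>u / v\<close> in lowest terms. If \<open>k\<close> is the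
  value at \<open>n\<close>, then \<open>u * poly h n = v * k\<close>, and coprimality gives
  \<open>u dvd k\<close>. So the numerator divides all values.\<close>

lemma image_primitive_smult_of_int:
  assumes "image_primitive (smult \<alpha> (map_poly of_int h))"
  obtains s v :: int where "\<alpha> = of_int s / of_int v" "s \<in> {1, -1}" "v > 0"
proof -
  obtain u v where uv: "quotient_of \<alpha> = (u, v)" by fastforce
  then have \<alpha>: "\<alpha> = of_int u / of_int v" and v: "v > 0" and cop: "coprime u v"
    using quotient_of_div quotient_of_denom_pos quotient_of_coprime by blast+
  have "\<exists>m. poly (smult \<alpha> (map_poly of_int h)) (of_int n) = of_int (u * m)" for n
  proof -
    obtain k where k: "poly (smult \<alpha> (map_poly of_int h)) (of_int n) = of_int k"
      using assms by (metis image_primitive_def int_valued_simps(1) Ints_cases)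
    then have "of_int (u * poly h n) = (of_int (v * k) :: rat)"
      using v by (simp add: \<alpha> poly_map_poly_of_int field_simps)
    then have "u * poly h n = v * k" by (simp only: of_int_eq_iff)
    then have "u dvd k" using cop by (metis coprime_dvd_mult_right_iff dvd_triv_left)
    then show ?thesis using k by auto
  qed
  then have "is_unit u" by (rule image_primitive_imp_unit[OF assms])
  then have "u \<in> {1, -1}" by (auto simp: zdvd1_eq)
  then show ?thesis using that \<alpha> v by blast
qed

section \<open>Coverings and divisibility of values\<close>

lemma minimal_covering_subset: "minimal_covering q g A J \<Longrightarrow> J \<subseteq> A"
  by (simp add: minimal_covering_def covering_def)

text \<open>The ambient index set enters a covering only through the inclusion of \<open>J\<close>,
  so it may be shrunk as well as enlarged. Both directions are used.\<close>

lemma minimal_covering_mono: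
  assumes "minimal_covering q g A J" "J \<subseteq> B"
  shows "minimal_covering q g B J"
proof -
  have "covering q g B J' \<longleftrightarrow> covering q g A J'" if "J' \<subseteq> J" for J'
    using assms that unfolding minimal_covering_def covering_def by auto
  then show ?thesis using assms(1) unfolding minimal_covering_def by blast
qed

text \<open>The residue of \<open>n\<close> is a root of one covering polynomial, and that single
  factor already supplies the divisor \<open>q\<close>.\<close>

lemma covering_imp_dvd_prod:
  assumes "covering q g A J" "finite A" "q > 0"
  shows "q dvd poly (\<Prod>i\<in>A. g i) n"
proof -
  have "n mod q \<in> (\<Union>i\<in>J. roots_mod q (g i))"
    using assms by (simp add: covering_def)
  then obtain i where "i \<in> A" "q dvd poly (g i) n"
    using assms(1) by (auto simp: covering_def roots_mod_def dvd_poly_mod_iff)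
  moreover from this have "poly (g i) n dvd poly (\<Prod>i\<in>A. g i) n"
    using assms(2) by (auto simp: poly_prod intro: dvd_prodI)
  ultimately show ?thesis by (blast intro: dvd_trans)
qed

text \<open>A prime dividing a product divides a factor, so the indices having at least one root
  modulo \<open>q\<close> form a covering. A finite index set then has an inclusion-minimal
  one.\<close>

lemma minimal_covering_exists:
  assumes "Factorial_Ring.prime q" "finite A" "\<And>n. q dvd poly (\<Prod>i\<in>A. g i) n"
  shows "\<exists>J. minimal_covering q g A J"
proof -
  let ?B = "{i\<in>A. roots_mod q (g i) \<noteq> {}}" and ?C = "{J. covering q g A J}"
  have "{0..q - 1} \<subseteq> (\<Union>i\<in>?B. roots_mod q (g i))"
  proof
    fix j assume j: "j \<in> {0..q - 1}"
    have "q dvd (\<Prod>i\<in>A. poly (g i) j)" using assms(3)[of j] by (simp add: poly_prod)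
    then obtain i where "i \<in> A" "q dvd poly (g i) j"
      using assms(1,2) by (auto simp: prime_dvd_prod_iff)
    then have "i \<in> ?B" "j \<in> roots_mod q (g i)" using j by (auto simp: roots_mod_def)
    then show "j \<in> (\<Union>i\<in>?B. roots_mod q (g i))" by blast
  qed
  moreover have "(\<Union>i\<in>?B. roots_mod q (g i)) \<subseteq> {0..q - 1}" unfolding roots_mod_def by blast
  ultimately have "?B \<in> ?C" unfolding covering_def by blast
  moreover have "finite ?C"
    by (rule finite_subset[of _ "Pow A"]) (use assms(2) in \<open>auto simp: covering_def\<close>)
  ultimately obtain J where "J \<in> ?C" "\<forall>J'\<in>?C. J' \<subseteq> J \<longrightarrow> J = J'"
    using finite_has_minimal[of ?C] by blast
  then show ?thesis unfolding minimal_covering_def by blast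
qed

lemma covering_nonempty:
  assumes "covering q g A J" "q > 0"
  shows "J \<noteq> {}"
proof
  assume "J = {}"
  then have "{0..q - 1} = {}" using assms(1) by (simp add: covering_def)
  then show False using assms(2) by simp
qed

section \<open>Quotients of products of the polynomials by products of the primes\<close>

text \<open>Positive degree is what the content condition and image primitivity provide together;
  with it, a constant quotient has no polynomial factors left.\<close>

locale irreducible_family =
  fixes I :: "'i set" and K :: "'k set" and g :: "'i \<Rightarrow> int poly" and p :: "'k \<Rightarrow> int"
  assumes finite_I: "finite I" and finite_K: "finite K" and inj_p: "inj_on p K"
    and irreducible_g: "i \<in> I \<Longrightarrow> Factorial_Ring.irreducible (g i)"
    and degree_g: "i \<in> I \<Longrightarrow> degree (g i) > 0"
    and prime_p: "k \<in> K \<Longrightarrow> Factorial_Ring.prime (p k)"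
begin

abbreviation Q :: "'i set \<Rightarrow> 'k set \<Rightarrow> rat poly" where
  "Q \<equiv> quot_poly p g"

lemma finite_sub: "A \<subseteq> I \<Longrightarrow> finite A" "S \<subseteq> K \<Longrightarrow> finite S"
  using finite_I finite_K finite_subset by auto

lemma prod_p_pos: "S \<subseteq> K \<Longrightarrow> prod p S > 0"
  using prime_p prime_gt_0_int by (intro prod_pos) blast

lemma poly_quot: "poly (Q A S) (of_int n) = of_int (poly (prod g A) n) / of_int (prod p S)"
  by (simp add: quot_poly_def poly_map_poly_of_int)

lemma quot_empty [simp]: "Q {} {} = 1"
  by (simp add: quot_poly_def)

lemma quot_union:
  assumes "A \<subseteq> I" "B \<subseteq> I" "A \<inter> B = {}" "S \<subseteq> K" "T \<subseteq> K" "S \<inter> T = {}"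
  shows "Q (A \<union> B) (S \<union> T) = Q A S * Q B T"
  using assms by (simp add: quot_poly_def prod.union_disjoint finite_sub map_poly_of_int_mult mult.commute)

lemma quot_split:
  assumes "A \<subseteq> I" "S \<subseteq> K" "B \<subseteq> A" "T \<subseteq> S"
  shows "Q A S = Q B T * Q (A - B) (S - T)"
proof -
  have "B \<union> (A - B) = A" "T \<union> (S - T) = S" using assms by auto
  then show ?thesis using quot_union[of B "A - B" T "S - T"] assms by auto
qed

lemma quot_UN:
  assumes "finite X" "disjoint_family_on B X" "disjoint_family_on T X"
    and "\<And>j. j \<in> X \<Longrightarrow> B j \<subseteq> I" "\<And>j. j \<in> X \<Longrightarrow> T j \<subseteq> K"
  shows "(\<Prod>j\<in>X. Q (B j) (T j)) = Q (\<Union>j\<in>X. B j) (\<Union>j\<in>X. T j)"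
  using assms
proof (induction X rule: finite_induct)
  case (insert j X)
  have "B j \<inter> (\<Union>j\<in>X. B j) = {}" "T j \<inter> (\<Union>j\<in>X. T j) = {}"
    using insert.prems(1,2) insert.hyps(2) by (auto simp: disjoint_family_on_def)
  moreover have "(\<Union>j\<in>X. B j) \<subseteq> I" "(\<Union>j\<in>X. T j) \<subseteq> K" using insert.prems(3,4) by blast+
  ultimately have "Q (\<Union>j\<in>insert j X. B j) (\<Union>j\<in>insert j X. T j) =
      Q (B j) (T j) * Q (\<Union>j\<in>X. B j) (\<Union>j\<in>X. T j)"
    using insert.prems(3,4) by (subst quot_union[symmetric]) auto
  moreover have "disjoint_family_on B X" "disjoint_family_on T X"
    using insert.prems(1,2) by (auto simp: disjoint_family_on_def)
  ultimately show ?case using insert by simp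
qed simp

lemma quot_nonzero: "A \<subseteq> I \<Longrightarrow> S \<subseteq> K \<Longrightarrow> Q A S \<noteq> 0"
proof -
  assume AS: "A \<subseteq> I" "S \<subseteq> K"
  have "prod g A \<noteq> 0" using AS degree_g by (force simp: finite_sub prod_zero_iff)
  then have "map_poly of_int (prod g A) \<noteq> (map_poly of_int 0 :: rat poly)"
    by (simp only: map_poly_of_int_eq_iff not_False_eq_True)
  then show ?thesis using prod_p_pos[OF AS(2)] by (simp add: quot_poly_def del: of_int_prod)
qed

lemma quot_unit_imp_empty:
  assumes "A \<subseteq> I" "Q A S \<in> {1, -1}" "S \<subseteq> K"
  shows "A = {}"
proof (rule ccontr)
  assume "A \<noteq> {}"
  then obtain i where i: "i \<in> A" by auto
  have "degree (Q A S) = 0" using assms(2) by auto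
  then have "degree (prod g A) = 0"
    using prod_p_pos[OF assms(3)] by (simp add: quot_poly_def degree_map_poly del: of_int_prod)
  moreover have "degree (prod g A) = (\<Sum>i\<in>A. degree (g i))"
    using assms(1) degree_g by (intro degree_prod_eq_sum_degree) force
  ultimately have "degree (g i) = 0" using i finite_sub(1)[OF assms(1)] by simp
  then show False using i degree_g[of i] assms(1) by auto
qed

text \<open>Distinct primes are coprime, so \<open>prod p S\<close> divides all values of
  \<open>prod g A\<close> iff each \<open>p k\<close> does. One prime at a time, this is the
  existence of a covering inside \<open>A\<close>.\<close>

lemma quot_in_carrier_iff:
  assumes "A \<subseteq> I" "S \<subseteq> K"
  shows "Q A S \<in> carrier int_valued \<longleftrightarrow> (\<forall>k\<in>S. \<exists>J. minimal_covering (p k) g A J)"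
proof
  assume int: "Q A S \<in> carrier int_valued"
  show "\<forall>k\<in>S. \<exists>J. minimal_covering (p k) g A J"
  proof
    fix k assume k: "k \<in> S"
    have "p k dvd poly (prod g A) n" for n
    proof -
      obtain m where "poly (Q A S) (of_int n) = of_int m"
        using int by (metis int_valued_simps(1) Ints_cases)
      then have "of_int (poly (prod g A) n) = (of_int (prod p S * m) :: rat)"
        using prod_p_pos[OF assms(2)] by (simp add: poly_quot field_simps del: of_int_prod)
      then have "poly (prod g A) n = prod p S * m" by (simp only: of_int_eq_iff)
      moreover have "p k dvd prod p S" using k assms(2) by (intro dvd_prodI) (auto simp: finite_sub)
      ultimately show ?thesis by simp
    qed
    then show "\<exists>J. minimal_covering (p k) g A J"
      using prime_p k assms by (intro minimal_covering_exists) (auto simp: finite_sub)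
  qed
next
  assume cov: "\<forall>k\<in>S. \<exists>J. minimal_covering (p k) g A J"
  have "poly (Q A S) (of_int n) \<in> \<int>" for n
  proof -
    have "prod p S dvd poly (prod g A) n"
    proof (rule prod_primes_dvd)
      fix k assume k: "k \<in> S"
      then obtain J where "covering (p k) g A J" using cov by (auto simp: minimal_covering_def)
      then show "p k dvd poly (prod g A) n"
        using covering_imp_dvd_prod[of "p k" g A J n] prime_gt_0_int[OF prime_p] k assms
        by (auto simp: finite_sub)
    qed (use assms prime_p inj_p in \<open>auto simp: finite_sub intro: inj_on_subset\<close>)
    then obtain m where "poly (prod g A) n = prod p S * m" by blast
    then show ?thesis using prod_p_pos[OF assms(2)] by (simp add: poly_quot del: of_int_prod)
  qed
  then show "Q A S \<in> carrier int_valued" by simp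
qed

lemma covering_p_nonempty: "k \<in> K \<Longrightarrow> minimal_covering (p k) g A J \<Longrightarrow> J \<noteq> {}"
  using covering_nonempty[of "p k" g A J] prime_gt_0_int[OF prime_p] unfolding minimal_covering_def by blast

text \<open>Coverings for a prime are nonempty, so no prime can be covered from the empty index set.
  Later, an empty index set thus forces the quotient to be \<open>1\<close>.\<close>

lemma quot_empty_in_carrier: "S \<subseteq> K \<Longrightarrow> Q {} S \<in> carrier int_valued \<Longrightarrow> S = {}"
  using quot_in_carrier_iff[of "{}" S] covering_p_nonempty minimal_covering_subset by blast

text \<open>Unique factorization in \<open>\<int>[X]\<close> determines a factor of \<open>Q A S\<close> up to a rational scalar, and
  image primitivity forces the numerator of that scalar to be a unit.\<close>

lemma quot_factor:
  assumes "A \<subseteq> I" "S \<subseteq> K" "a \<in> carrier int_valued" "b \<in> carrier int_valued"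
    and ab: "a * b = Q A S" and prim: "image_primitive (Q A S)"
  obtains B T s where "B \<subseteq> A" "T \<subseteq> S" "s \<in> {1, -1 :: rat}"
    "a = smult s (Q B T)" "b = smult s (Q (A - B) (S - T))"
proof -
  let ?r = "map_poly of_int :: int poly \<Rightarrow> rat poly" and ?d = "prod p S"
  obtain m a' where a': "m > 0" "smult (of_int m) a = ?r a'" by (rule rat_poly_clear_denominators)
  obtain n b' where b': "n > 0" "smult (of_int n) b = ?r b'" by (rule rat_poly_clear_denominators)
  have d: "?d > 0" using prod_p_pos[OF assms(2)] .
  \<comment> \<open>Clearing all denominators gives an identity in the integer polynomial ring,
    where the \<open>g i\<close> are prime. The factor \<open>?d\<close> is attached to
    \<open>a'\<close>.\<close>
  have "?r ([:?d:] * a' * b') = smult (of_int (?d * m * n)) (a * b)"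
    by (simp add: map_poly_of_int_mult map_poly_smult ac_simps del: of_int_prod flip: a'(2) b'(2))
  also have "\<dots> = ?r ([:m * n:] * prod g A)"
    using d by (simp add: ab quot_poly_def map_poly_smult del: of_int_prod)
  finally have "([:?d:] * a') * b' = [:m * n:] * prod g A" by (simp only: map_poly_of_int_eq_iff)
  moreover have "prime_elem (g i)" if "i \<in> A" for i
    using irreducible_g that assms(1) by (intro irreducible_imp_prime_elem) blast
  ultimately obtain B c1 c2 where B: "B \<subseteq> A" "c1 * c2 = [:m * n:]"
      "[:?d:] * a' = c1 * prod g B" "b' = c2 * prod g (A - B)"
    using prime_elem_prod_split[of A g "[:?d:] * a'" b' "[:m * n:]"] assms(1) by (auto simp: finite_sub)
  \<comment> \<open>The leftover cofactors have a nonzero constant product, hence are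
    constants.\<close>
  have "c1 * c2 \<noteq> 0" using B(2) a'(1) b'(1) by simp
  then have "degree c1 + degree c2 = 0" using B(2) by (metis degree_mult_eq degree_pCons_0 mult_zero_left mult_zero_right)
  then obtain \<gamma>1 \<gamma>2 where c: "c1 = [:\<gamma>1:]" "c2 = [:\<gamma>2:]" by (auto elim!: degree_eq_zeroE)
  \<comment> \<open>The denominators undo the clearing: \<open>m\<close> and the attached
    \<open>?d\<close> for \<open>a\<close>, and \<open>n\<close> for \<open>b\<close>.\<close>
  define \<alpha> \<beta> :: rat where "\<alpha> = of_int \<gamma>1 / of_int (?d * m)" and "\<beta> = of_int \<gamma>2 / of_int n"
  have "smult (of_int (?d * m)) a = ?r ([:?d:] * a')"
    by (simp add: map_poly_smult del: of_int_prod flip: a'(2))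
  also have "\<dots> = smult (of_int \<gamma>1) (?r (prod g B))"
    by (simp only: B(3) c) (simp add: map_poly_smult)
  finally have "smult (1 / of_int (?d * m)) (smult (of_int (?d * m)) a) =
      smult (1 / of_int (?d * m)) (smult (of_int \<gamma>1) (?r (prod g B)))" by (rule arg_cong)
  then have a: "a = smult \<alpha> (?r (prod g B))" using d a'(1) by (simp add: \<alpha>_def del: of_int_prod)
  have "smult (of_int n) b = smult (of_int \<gamma>2) (?r (prod g (A - B)))"
    by (simp add: b'(2) B(4) c map_poly_smult)
  then have "smult (1 / of_int n) (smult (of_int n) b) =
      smult (1 / of_int n) (smult (of_int \<gamma>2) (?r (prod g (A - B))))" by (rule arg_cong)
  then have b: "b = smult \<beta> (?r (prod g (A - B)))" using b'(1) by (simp add: \<beta>_def)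
  have "image_primitive a" "image_primitive b"
    using image_primitive_factor[of a b] image_primitive_factor[of b a] assms by (simp_all add: mult.commute)
  then obtain s v s' w where sv: "\<alpha> = of_int s / of_int v" "s \<in> {1, -1}" "v > 0"
      and sw: "\<beta> = of_int s' / of_int w" "s' \<in> {1, -1}" "w > 0"
    using image_primitive_smult_of_int a b by metis
  \<comment> \<open>Both scalars multiply the same nonzero polynomial \<open>Q A {}\<close>, so they
    can be compared.\<close>
  have "\<alpha> * \<beta> = 1 / of_int ?d"
  proof -
    have "smult (\<alpha> * \<beta>) (Q A {}) = a * b"
      using quot_split[of A "{}" B "{}"] assms(1) B(1) by (simp add: a b quot_poly_def ac_simps)
    also have "\<dots> = smult (1 / of_int ?d) (Q A {})" by (simp add: ab quot_poly_def)
    finally have "smult (\<alpha> * \<beta> - 1 / of_int ?d) (Q A {}) = 0" by (simp add: smult_diff_left)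
    then show ?thesis using quot_nonzero[of A "{}"] assms(1) by simp
  qed
  then have "of_int (s * s' * ?d) = (of_int (v * w) :: rat)"
    using sv(1,3) sw(1,3) d by (simp add: field_simps del: of_int_prod)
  then have vw: "s * s' * ?d = v * w" by (simp only: of_int_eq_iff)
  \<comment> \<open>In \<open>vw\<close> the numbers \<open>v\<close>, \<open>w\<close> and
    \<open>?d\<close> are positive, so the two signs agree. Then \<open>v\<close> and
    \<open>w\<close> are complementary divisors of a product of primes, which yields
    \<open>T\<close>.\<close>
  have "s = s'"
  proof (rule ccontr)
    assume "s \<noteq> s'"
    then have "s * s' = -1" using sv(2) sw(2) by auto
    moreover have "v * w > 0" using sv(3) sw(3) by simp
    ultimately show False using vw d by simp
  qed
  then have "s * s' = 1" using sv(2) by auto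
  then have "v * w = ?d" using vw by simp
  then obtain T where T: "T \<subseteq> S" "v = prod p T" "w = prod p (S - T)"
    using mult_eq_prod_primes_split[of S p v w] sv(3) prime_p assms(2) finite_sub by blast
  show ?thesis
  proof (rule that[OF B(1) T(1)])
    show "(of_int s :: rat) \<in> {1, -1}" using sv(2) by auto
    show "a = smult (of_int s) (Q B T)" by (simp add: a sv(1) T(2) quot_poly_def)
    show "b = smult (of_int s) (Q (A - B) (S - T))" by (simp add: b sw(1) T(3) quot_poly_def \<open>s = s'\<close>)
  qed
qed

section \<open>Irreducibility criteria for quotients\<close>

lemma smult_unit_in_carrier_iff:
  "s \<in> {1, -1 :: rat} \<Longrightarrow> smult s h \<in> carrier int_valued \<longleftrightarrow> h \<in> carrier int_valued"
  by auto

text \<open>By \<open>quot_factor\<close>, products of two factors are simultaneous splittings of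
  \<open>A\<close> and \<open>S\<close>, up to sign. Testing \<open>B\<close> suffices: an
  integer-valued quotient with empty index set has no primes either, so \<open>B = {}\<close> and
  \<open>B = A\<close> both give a unit factor.\<close>

lemma irreducible_quot_iff_split:
  assumes "A \<subseteq> I" "S \<subseteq> K" "image_primitive (Q A S)"
  shows "Divisibility.irreducible int_valued (Q A S) \<longleftrightarrow> A \<noteq> {} \<and>
    (\<forall>B\<subseteq>A. \<forall>T\<subseteq>S. Q B T \<in> carrier int_valued \<longrightarrow> Q (A - B) (S - T) \<in> carrier int_valued \<longrightarrow>
       B = {} \<or> B = A)" (is "_ \<longleftrightarrow> ?R")
proof -
  have carr: "Q A S \<in> carrier int_valued" using assms(3) by (simp add: image_primitive_def)
  note iff = irreducible_int_valued_iff[OF carr quot_nonzero[OF assms(1,2)]]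
  show ?thesis
  proof
    assume "Divisibility.irreducible int_valued (Q A S)"
    note irr = this[unfolded iff]
    have "A \<noteq> {}"
    proof
      assume "A = {}"
      then have "S = {}" using carr quot_empty_in_carrier[OF assms(2)] by blast
      then show False using irr \<open>A = {}\<close> by simp
    qed
    moreover have "B = {} \<or> B = A" if "B \<subseteq> A" "T \<subseteq> S" "Q B T \<in> carrier int_valued"
      "Q (A - B) (S - T) \<in> carrier int_valued" for B T
    proof -
      have "Q B T \<in> {1, -1} \<or> Q (A - B) (S - T) \<in> {1, -1}"
        using irr that quot_split[OF assms(1,2) that(1,2)] by metis
      then have "B = {} \<or> A - B = {}"
        using quot_unit_imp_empty[of B T] quot_unit_imp_empty[of "A - B" "S - T"] that assms(1,2) by blast
      then show ?thesis using that(1) by blast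
    qed
    ultimately show ?R by blast
  next
    assume R: ?R
    have "a \<in> {1, -1} \<or> b \<in> {1, -1}"
      if ab: "a \<in> carrier int_valued" "b \<in> carrier int_valued" "a * b = Q A S" for a b
    proof -
      from quot_factor[OF assms(1,2) ab assms(3)] obtain B T s
        where BT: "B \<subseteq> A" "T \<subseteq> S" and s: "s \<in> {1, -1 :: rat}"
          and eq: "a = smult s (Q B T)" "b = smult s (Q (A - B) (S - T))" by metis
      have carr: "Q B T \<in> carrier int_valued" "Q (A - B) (S - T) \<in> carrier int_valued"
        using ab(1,2) smult_unit_in_carrier_iff[OF s] unfolding eq by blast+
      have unit: "smult s 1 \<in> {1, -1}" using s by (auto simp: one_pCons)
      from carr have "B = {} \<or> B = A" using R BT by blast
      then show ?thesis
      proof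
        assume "B = {}"
        then have "T = {}" using quot_empty_in_carrier[of T] carr(1) BT(2) assms(2) by blast
        then show ?thesis using \<open>B = {}\<close> unit eq(1) by simp
      next
        assume "B = A"
        then have "S - T = {}" using quot_empty_in_carrier[of "S - T"] carr(2) assms(2) by auto
        then have "b = smult s 1" using \<open>B = A\<close> eq(2) by (simp only: Diff_cancel quot_empty)
        then show ?thesis using unit by blast
      qed
    qed
    moreover have "Q A S \<notin> {1, -1}" using R quot_unit_imp_empty[OF assms(1) _ assms(2)] by blast
    ultimately show "Divisibility.irreducible int_valued (Q A S)" unfolding iff by blast
  qed
qed

text \<open>Without denominators every subset of \<open>A\<close> gives a legitimate factor, so
  \<open>A\<close> must be nonempty without proper nonempty subsets.\<close>

lemma irreducible_quot_no_prime_iff: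
  assumes "A \<subseteq> I" "image_primitive (Q A {})"
  shows "Divisibility.irreducible int_valued (Q A {}) \<longleftrightarrow> (\<exists>i. A = {i})"
proof -
  have "Q B {} \<in> carrier int_valued" if "B \<subseteq> A" for B
    using quot_in_carrier_iff[of B "{}"] that assms(1) by auto
  then have "Divisibility.irreducible int_valued (Q A {}) \<longleftrightarrow> A \<noteq> {} \<and> (\<forall>B\<subseteq>A. B = {} \<or> B = A)"
    unfolding irreducible_quot_iff_split[OF assms(1) empty_subsetI assms(2)] by (auto simp del: int_valued_simps(1))
  also have "\<dots> \<longleftrightarrow> (\<exists>i. A = {i})"
    by (auto simp: subset_singleton_iff)
  finally show ?thesis .
qed

text \<open>A violation of either condition exhibits a proper splitting of the quotient. Conversely,
  coverings chosen inside the two parts of a splitting form one family, to which the conditions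
  apply.\<close>

lemma irreducible_quot_iff:
  assumes "A \<subseteq> I" "S \<subseteq> K" "S \<noteq> {}" "image_primitive (Q A S)"
  shows "Divisibility.irreducible int_valued (Q A S) \<longleftrightarrow> irreducibility_conditions p g A S"
proof
  assume "Divisibility.irreducible int_valued (Q A S)"
  then have split: "B = {} \<or> B = A" if "B \<subseteq> A" "T \<subseteq> S" "Q B T \<in> carrier int_valued"
      "Q (A - B) (S - T) \<in> carrier int_valued" for B T
    using that irreducible_quot_iff_split[OF assms(1,2,4)] by blast
  show "irreducibility_conditions p g A S"
    unfolding irreducibility_conditions_def
  proof (intro allI impI conjI notI)
    fix J' assume J': "minimal_coverings p g A S J'"
    let ?U = "\<lambda>T. \<Union>k\<in>T. J' k"
    have J'_cov: "minimal_covering (p k) g A (J' k)" if "k \<in> S" for k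
      using J' that by (simp add: minimal_coverings_def)
    have U_sub: "?U T \<subseteq> A" if "T \<subseteq> S" for T
      using J'_cov that minimal_covering_subset by blast
    have U_nonempty: "?U T \<noteq> {}" if "T \<subseteq> S" "T \<noteq> {}" for T
      using that J'_cov covering_p_nonempty assms(2) by (fastforce simp: ex_in_conv)
    have carr: "Q B T \<in> carrier int_valued" if "B \<subseteq> A" "T \<subseteq> S" "?U T \<subseteq> B" for B T
    proof -
      have "\<forall>k\<in>T. minimal_covering (p k) g B (J' k)"
        using J'_cov that by (blast intro: minimal_covering_mono)
      then show ?thesis using quot_in_carrier_iff[of B T] that assms(1,2) by blast
    qed
    \<comment> \<open>The indices missed by all coverings could be split off with no prime; since
      \<open>?U S\<close> is nonempty, there are none.\<close>
    show whole: "A = ?U S"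
      using split[of "?U S" S] carr[of "?U S" S] carr[of "A - ?U S" "{}"] U_sub[of S] U_nonempty[of S] assms(3)
      by auto
    assume "\<exists>X Y. X \<noteq> {} \<and> Y \<noteq> {} \<and> X \<inter> Y = {} \<and> X \<union> Y = S \<and> ?U X \<inter> ?U Y = {}"
    then obtain X Y where XY: "X \<noteq> {}" "Y \<noteq> {}" "X \<inter> Y = {}" "X \<union> Y = S" "?U X \<inter> ?U Y = {}"
      by blast
    \<comment> \<open>The two unions are now complementary in \<open>A\<close>, so \<open>X\<close>
      and \<open>Y\<close> split the quotient with both index sets nonempty.\<close>
    have "?U X \<union> ?U Y = A" unfolding whole XY(4)[symmetric] by blast
    then have "?U Y \<subseteq> A - ?U X" "S - X = Y" "X \<subseteq> S" "Y \<subseteq> S" using XY by auto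
    then have "?U X = {} \<or> ?U X = A"
      using split[of "?U X" X] carr[of "?U X" X] carr[of "A - ?U X" Y] U_sub[of X] by auto
    then show False using U_nonempty[of X] U_nonempty[of Y] XY \<open>?U X \<union> ?U Y = A\<close> by blast
  qed
next
  assume cond: "irreducibility_conditions p g A S"
  have carr: "Q A S \<in> carrier int_valued" using assms(4) by (simp add: image_primitive_def)
  obtain k J where kJ: "k \<in> S" "minimal_covering (p k) g A J"
    using carr assms(3) quot_in_carrier_iff[OF assms(1,2)] by blast
  have "A \<noteq> {}"
    using covering_p_nonempty[of k A J] minimal_covering_subset[OF kJ(2)] kJ assms(2) by blast
  moreover have "B = {} \<or> B = A" if BT: "B \<subseteq> A" "T \<subseteq> S" "Q B T \<in> carrier int_valued"
      "Q (A - B) (S - T) \<in> carrier int_valued" for B T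
  proof -
    have "\<forall>k\<in>T. \<exists>J. minimal_covering (p k) g B J" "\<forall>k\<in>S-T. \<exists>J. minimal_covering (p k) g (A-B) J"
      using BT quot_in_carrier_iff[of B T] quot_in_carrier_iff[of "A - B" "S - T"] assms(1,2) by blast+
    then obtain J1 J2 where J1: "\<forall>k\<in>T. minimal_covering (p k) g B (J1 k)"
        and J2: "\<forall>k\<in>S-T. minimal_covering (p k) g (A-B) (J2 k)"
      by metis
    \<comment> \<open>Each prime keeps the covering found in the factor whose denominator contains
      it.\<close>
    define J' where "J' k = (if k \<in> T then J1 k else J2 k)" for k
    have sub: "(\<Union>k\<in>T. J' k) \<subseteq> B" "(\<Union>k\<in>S-T. J' k) \<subseteq> A - B"
      using J1 J2 minimal_covering_subset unfolding J'_def by fastforce+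
    have "minimal_covering (p k) g A (J' k)" if "k \<in> S" for k
    proof (cases "k \<in> T")
      case True
      then have "minimal_covering (p k) g B (J' k)" using J1 by (simp add: J'_def)
      then show ?thesis using minimal_covering_subset BT(1) by (blast intro: minimal_covering_mono)
    next
      case False
      then have "minimal_covering (p k) g (A - B) (J' k)" using J2 that by (simp add: J'_def)
      then show ?thesis using minimal_covering_subset by (blast intro: minimal_covering_mono)
    qed
    then have "minimal_coverings p g A S J'" by (simp add: minimal_coverings_def)
    note this_cond = cond[unfolded irreducibility_conditions_def, THEN spec[of _ J'], THEN mp, OF this]
    have whole: "A = (\<Union>k\<in>S. J' k)" and nosplit: "\<not> (\<exists>X Y. X \<noteq> {} \<and> Y \<noteq> {} \<and> X \<inter> Y = {} \<and>
        X \<union> Y = S \<and> (\<Union>k\<in>X. J' k) \<inter> (\<Union>k\<in>Y. J' k) = {})"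
      using this_cond by (rule conjunct1, rule conjunct2)
    have disjoint: "(\<Union>k\<in>T. J' k) \<inter> (\<Union>k\<in>S-T. J' k) = {}" using sub by blast
    \<comment> \<open>Condition (ii) sends all primes to one factor; condition (i) then forces all
      of \<open>A\<close> into the same factor.\<close>
    have "T = {} \<or> S - T = {}"
    proof (rule ccontr)
      assume "\<not> (T = {} \<or> S - T = {})"
      moreover have "T \<inter> (S - T) = {}" "T \<union> (S - T) = S" using BT(2) by auto
      ultimately show False using disjoint nosplit by metis
    qed
    then show ?thesis
    proof
      assume "T = {}"
      then have "A \<subseteq> A - B" using whole sub(2) by simp
      then show ?thesis using BT(1) by blast
    next
      assume "S - T = {}"
      then have "S = T" using BT(2) by blast
      then have "A \<subseteq> B" using whole sub(1) by simp
      then show ?thesis using BT(1) by blast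
    qed
  qed
  ultimately show "Divisibility.irreducible int_valued (Q A S)"
    unfolding irreducible_quot_iff_split[OF assms(1,2,4)] by blast
qed

section \<open>Factorizations and admissible covering families\<close>

lemma image_primitive_quot:
  assumes "image_primitive (Q A S)" "A \<subseteq> I" "S \<subseteq> K" "B \<subseteq> A" "T \<subseteq> S"
    "Q B T \<in> carrier int_valued" "Q (A - B) (S - T) \<in> carrier int_valued"
  shows "image_primitive (Q B T)"
  using image_primitive_factor[of "Q B T" "Q (A - B) (S - T)"] quot_split[of A S B T] assms by simp

text \<open>Repeated use of \<open>quot_factor\<close> peels off the head. The sign \<open>s\<close>
  is part of the induction because the remaining product is a quotient only up to sign. Indexing by
  list positions ties each part to its own factor.\<close>

lemma factorization_into_quots:
  assumes "set fs \<subseteq> carrier int_valued" "A \<subseteq> I" "S \<subseteq> K" "image_primitive (Q A S)"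
    "s \<in> {1, -1 :: rat}" "foldr (*) fs 1 = smult s (Q A S)"
  shows "\<exists>B T. disjoint_family_on B {..<length fs} \<and> (\<Union>j<length fs. B j) = A \<and>
    disjoint_family_on T {..<length fs} \<and> (\<Union>j<length fs. T j) = S \<and>
    (\<forall>j<length fs. image_primitive (Q (B j) (T j)) \<and> (\<exists>s\<in>{1, -1}. fs ! j = smult s (Q (B j) (T j))))"
  using assms
proof (induction fs arbitrary: A S s)
  case Nil
  have carr: "Q A S \<in> carrier int_valued" using Nil.prems by (simp add: image_primitive_def)
  have "Q A S = smult s (smult s (Q A S))" using Nil.prems(5) by auto
  also have "\<dots> = smult s 1" using Nil.prems(6) by simp
  finally have "Q A S \<in> {1, -1}" using Nil.prems(5) by (auto simp: one_pCons)
  then have "A = {}" using quot_unit_imp_empty Nil.prems(2,3) by blast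
  moreover from this have "S = {}" using carr quot_empty_in_carrier Nil.prems(3) by blast
  ultimately show ?case by (simp add: disjoint_family_on_def)
next
  case (Cons h fs)
  let ?P = "foldr (*) fs 1"
  have P: "?P \<in> carrier int_valued"
    using Cons.prems(1) by (induction fs) (auto simp del: int_valued_simps(1) intro: int_valued_mult, simp)
  \<comment> \<open>Moving the sign onto the head makes the whole product exactly
    \<open>Q A S\<close>, as \<open>quot_factor\<close> requires.\<close>
  have ss: "s * s = 1" using Cons.prems(5) by auto
  have "smult s h \<in> carrier int_valued"
    using Cons.prems(1,5) smult_unit_in_carrier_iff by auto
  moreover have "smult s h * ?P = Q A S" using Cons.prems(6) ss by simp
  ultimately obtain B\<^sub>0 T\<^sub>0 r where 0: "B\<^sub>0 \<subseteq> A" "T\<^sub>0 \<subseteq> S" "r \<in> {1, -1 :: rat}"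
      "smult s h = smult r (Q B\<^sub>0 T\<^sub>0)" "?P = smult r (Q (A - B\<^sub>0) (S - T\<^sub>0))"
    using quot_factor[OF Cons.prems(2,3) _ P _ Cons.prems(4)] by metis
  have carr: "Q B\<^sub>0 T\<^sub>0 \<in> carrier int_valued" "Q (A - B\<^sub>0) (S - T\<^sub>0) \<in> carrier int_valued"
    using smult_unit_in_carrier_iff[OF 0(3)] P \<open>smult s h \<in> carrier int_valued\<close> unfolding 0(4,5) by blast+
  have prim: "image_primitive (Q B\<^sub>0 T\<^sub>0)"
    using image_primitive_quot[OF Cons.prems(4,2,3) 0(1,2) carr] .
  have "A - (A - B\<^sub>0) = B\<^sub>0" "S - (S - T\<^sub>0) = T\<^sub>0" using 0(1,2) by auto
  then have prim': "image_primitive (Q (A - B\<^sub>0) (S - T\<^sub>0))"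
    using image_primitive_quot[OF Cons.prems(4,2,3), of "A - B\<^sub>0" "S - T\<^sub>0"] carr by auto
  have "set fs \<subseteq> carrier int_valued" "A - B\<^sub>0 \<subseteq> I" "S - T\<^sub>0 \<subseteq> K"
    using Cons.prems(1-3) by auto
  from Cons.IH[OF this prim' 0(3,5)] obtain B T where BT: "disjoint_family_on B {..<length fs}" "(\<Union>j<length fs. B j) = A - B\<^sub>0"
      "disjoint_family_on T {..<length fs}" "(\<Union>j<length fs. T j) = S - T\<^sub>0"
      "\<forall>j<length fs. image_primitive (Q (B j) (T j)) \<and> (\<exists>s\<in>{1, -1}. fs ! j = smult s (Q (B j) (T j)))"
    by (elim exE conjE)
  have head: "\<exists>s\<in>{1, -1}. h = smult s (Q B\<^sub>0 T\<^sub>0)"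
  proof -
    have "h = smult s (smult s h)" using ss by simp
    also have "\<dots> = smult (s * r) (Q B\<^sub>0 T\<^sub>0)" by (simp add: 0(4))
    finally show ?thesis using Cons.prems(5) 0(3) by auto
  qed
  \<comment> \<open>The head occupies position \<open>0\<close>; the parts of the tail shift by
    one.\<close>
  let ?B = "case_nat B\<^sub>0 B" and ?T = "case_nat T\<^sub>0 T"
  have ran: "{..<length (h # fs)} = insert 0 (Suc ` {..<length fs})"
    by (simp add: lessThan_Suc_eq_insert_0)
  have "disjoint_family_on ?B {..<length (h # fs)}" "disjoint_family_on ?T {..<length (h # fs)}"
    using BT(1-4) unfolding ran disjoint_family_on_def by (auto 0 3)
  moreover have "(\<Union>j<length (h # fs). ?B j) = A" "(\<Union>j<length (h # fs). ?T j) = S"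
    unfolding ran using BT(2,4) 0(1,2) by auto
  moreover have "\<forall>j<length (h # fs). image_primitive (Q (?B j) (?T j)) \<and>
      (\<exists>s\<in>{1, -1}. (h # fs) ! j = smult s (Q (?B j) (?T j)))"
    using BT(5) prim head by (simp add: All_less_Suc2)
  ultimately show ?case by blast
qed

text \<open>Blocks have disjoint primes and disjoint index sets, so their quotients multiply back to
  \<open>Q I K\<close> once the uncovered polynomials are included. Irreducibility comes from the
  two criteria, whose image primitivity is inherited from \<open>Q I K\<close>.\<close>

lemma admissible_imp_factors:
  assumes adm: "admissible p g I K J \<K>" and prim: "image_primitive (Q I K)"
  shows "Q I K = map_poly of_int (\<Prod>i\<in>uncovered I J \<K>. g i) * (\<Prod>T\<in>\<K>. Q (\<Union>k\<in>T. J k) T)"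
    and "mset fs = associated_factors p g I J \<K> \<Longrightarrow> set fs \<subseteq> carrier int_valued \<and>
      factors int_valued fs (Q I K) \<and> length fs = card (uncovered I J \<K>) + card \<K>"
proof -
  define U where "U T = (\<Union>k\<in>T. J k)" for T
  let ?N = "uncovered I J \<K>" and ?U = "\<Union>T\<in>\<K>. U T"
  have N: "?N = I - ?U" by (simp add: uncovered_def U_def)
  have cov: "minimal_covering (p k) g I (J k)" if "k \<in> K" for k
    using adm that by (simp add: admissible_def minimal_coverings_def)
  have U_eq: "U = (\<lambda>T. \<Union>k\<in>T. J k)" by (simp add: fun_eq_iff U_def)
  have part: "partition_on K \<K>" and disj: "disjoint_family_on U \<K>"
    using adm unfolding admissible_def partitionable_by_def U_eq by blast+
  have K: "\<Union>\<K> = K" using part by (rule partition_onD1[symmetric])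
  have fin: "finite \<K>" using K finite_K finite_UnionD by metis
  have T_sub: "T \<subseteq> K" if "T \<in> \<K>" for T using K that by blast
  have U_sub: "U T \<subseteq> I" if "T \<subseteq> K" for T
    using minimal_covering_subset[OF cov] that unfolding U_def by (intro UN_least) blast
  have carr: "Q B T \<in> carrier int_valued" if "T \<subseteq> K" "U T \<subseteq> B" "B \<subseteq> I" for B T
  proof -
    have "minimal_covering (p k) g B (J k)" if "k \<in> T" for k
      using minimal_covering_mono[OF cov] that \<open>T \<subseteq> K\<close> \<open>U T \<subseteq> B\<close> unfolding U_def by blast
    then show ?thesis using quot_in_carrier_iff[of B T] that by blast
  qed
  \<comment> \<open>If the coverings of the remaining primes avoid \<open>B\<close>, the
    complementary quotient is integer-valued too, so \<open>Q B T\<close> is a genuine factor of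
    \<open>Q I K\<close>.\<close>
  have prim_sub: "image_primitive (Q B T)"
    if "T \<subseteq> K" "U T \<subseteq> B" "B \<subseteq> I" "U (K - T) \<inter> B = {}" for B T
  proof (rule image_primitive_quot[OF prim])
    have "U (K - T) \<subseteq> I - B" using U_sub[of "K - T"] that(4) by blast
    then show "Q (I - B) (K - T) \<in> carrier int_valued" by (intro carr) auto
  qed (use that carr in \<open>auto simp del: int_valued_simps(1)\<close>)
  have "?U \<subseteq> I" using U_sub T_sub by blast
  have "(\<Prod>T\<in>\<K>. Q (U T) T) = Q ?U (\<Union>T\<in>\<K>. T)"
    using disj part U_sub T_sub fin
    by (intro quot_UN) (auto simp: disjoint_family_on_def partition_on_def disjoint_def)
  then have "(\<Prod>T\<in>\<K>. Q (U T) T) = Q ?U K" using K by simp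
  moreover have "map_poly of_int (\<Prod>i\<in>?N. g i) = Q ?N {}" by (simp add: quot_poly_def)
  moreover have "Q I K = Q ?N {} * Q ?U K"
    using quot_split[of I K ?U K] \<open>?U \<subseteq> I\<close> by (simp add: N mult.commute)
  ultimately show prod_eq: "Q I K = map_poly of_int (\<Prod>i\<in>?N. g i) * (\<Prod>T\<in>\<K>. Q (\<Union>k\<in>T. J k) T)"
    by (simp add: U_def)
  have irr_N: "Divisibility.irreducible int_valued (map_poly of_int (g i))"
      "map_poly of_int (g i) \<in> carrier int_valued" if "i \<in> ?N" for i
  proof -
    have "U K \<inter> {i} = {}" using that K unfolding N U_def by blast
    then have prim_i: "image_primitive (Q {i} {})"
      using prim_sub[of "{}" "{i}"] that by (auto simp: N U_def)
    have "Q {i} {} = map_poly of_int (g i)" by (simp add: quot_poly_def)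
    then show "Divisibility.irreducible int_valued (map_poly of_int (g i))"
        "map_poly of_int (g i) \<in> carrier int_valued"
      using prim_i irreducible_quot_no_prime_iff[of "{i}"] that by (auto simp: N image_primitive_def)
  qed
  have irr_K: "Divisibility.irreducible int_valued (Q (U T) T)" "Q (U T) T \<in> carrier int_valued"
    if T: "T \<in> \<K>" for T
  proof -
    \<comment> \<open>A prime outside \<open>T\<close> lies in another block, whose coverings are
      disjoint from those of \<open>T\<close>.\<close>
    have "U (K - T) \<inter> U T = {}"
    proof -
      have "J k \<inter> U T = {}" if k: "k \<in> K - T" for k
      proof -
        obtain T' where T': "T' \<in> \<K>" "k \<in> T'" using k K by blast
        then have "U T' \<inter> U T = {}" using disj T k by (auto simp: disjoint_family_on_def)
        then show ?thesis using T'(2) unfolding U_def by blast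
      qed
      then show ?thesis unfolding U_def by blast
    qed
    then have prim_T: "image_primitive (Q (U T) T)"
      using prim_sub[of T "U T"] T_sub[OF T] U_sub by blast
    then show "Q (U T) T \<in> carrier int_valued" by (simp add: image_primitive_def)
    have "T \<noteq> {}" using part T by (auto simp: partition_on_def)
    moreover have "irreducibility_conditions p g (U T) T"
      using adm T by (simp add: admissible_def U_def)
    ultimately show "Divisibility.irreducible int_valued (Q (U T) T)"
      using irreducible_quot_iff[of "U T" T] prim_T T_sub[OF T] U_sub by blast
  qed
  show "set fs \<subseteq> carrier int_valued \<and> factors int_valued fs (Q I K) \<and>
      length fs = card ?N + card \<K>" if fs: "mset fs = associated_factors p g I J \<K>"
  proof -
    have assoc: "associated_factors p g I J \<K> =
        image_mset (\<lambda>i. map_poly of_int (g i)) (mset_set ?N) + image_mset (\<lambda>T. Q (U T) T) (mset_set \<K>)"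
      by (simp add: associated_factors_def U_def)
    have fin_N: "finite ?N" using finite_I by (simp add: N)
    have "set fs = set_mset (associated_factors p g I J \<K>)" by (simp flip: fs)
    also have "\<dots> = (\<lambda>i. map_poly of_int (g i)) ` ?N \<union> (\<lambda>T. Q (U T) T) ` \<K>"
      using fin fin_N by (simp add: assoc)
    finally have set: "set fs = (\<lambda>i. map_poly of_int (g i)) ` ?N \<union> (\<lambda>T. Q (U T) T) ` \<K>" .
    have "foldr (*) fs 1 = prod_mset (mset fs)" by (simp add: prod_mset_prod_list prod_list.eq_foldr)
    also have "\<dots> = (\<Prod>i\<in>?N. map_poly of_int (g i)) * (\<Prod>T\<in>\<K>. Q (U T) T)"
      by (simp add: fs assoc prod_unfold_prod_mset)
    also have "\<dots> = Q I K" by (simp add: prod_eq map_poly_of_int_prod U_def)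
    finally have "factors int_valued fs (Q I K)"
      using irr_N(1) irr_K(1) unfolding factors_def set by (auto simp del: int_valued_simps(1))
    moreover have "length fs = card ?N + card \<K>"
      unfolding size_mset[symmetric] fs assoc by simp
    moreover have "set fs \<subseteq> carrier int_valued" using irr_N(2) irr_K(2) unfolding set by blast
    ultimately show ?thesis by blast
  qed
qed

text \<open>Positions carrying primes (\<open>N\<close>) supply the blocks \<open>T j\<close>;
  positions without primes (\<open>Z\<close>) are single polynomials. Choosing each covering inside
  the matching \<open>B j\<close>, condition (i) makes the coverings of a block exhaust
  \<open>B j\<close>, so the family recovers the factorization.\<close>

lemma factors_imp_admissible:
  assumes carr: "set fs \<subseteq> carrier int_valued" and fac: "factors int_valued fs (Q I K)"
    and prim: "image_primitive (Q I K)"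
  obtains J \<K> fs' where "admissible p g I K J \<K>" "mset fs' = associated_factors p g I J \<K>"
    "essentially_equal int_valued fs fs'"
proof -
  let ?n = "length fs"
  have "foldr (*) fs 1 = smult 1 (Q I K)" using fac by (simp add: factors_def)
  from factorization_into_quots[OF carr order_refl order_refl prim _ this]
  obtain B T where B: "disjoint_family_on B {..<?n}" "(\<Union>j<?n. B j) = I"
      and T: "disjoint_family_on T {..<?n}" "(\<Union>j<?n. T j) = K"
      and BT: "\<forall>j<?n. image_primitive (Q (B j) (T j)) \<and> (\<exists>s\<in>{1, -1}. fs ! j = smult s (Q (B j) (T j)))"
    by blast
  have sub: "B j \<subseteq> I" "T j \<subseteq> K" if "j < ?n" for j using that B(2) T(2) by blast+
  have B_disj: "B i \<inter> B j = {}" if "i < ?n" "j < ?n" "i \<noteq> j" for i j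
    using B(1) that by (simp add: disjoint_family_on_def)
  have T_disj: "T i \<inter> T j = {}" if "i < ?n" "j < ?n" "i \<noteq> j" for i j
    using T(1) that by (simp add: disjoint_family_on_def)
  have prim_j: "image_primitive (Q (B j) (T j))" if "j < ?n" for j using BT that by blast
  have carr_j: "Q (B j) (T j) \<in> carrier int_valued" if "j < ?n" for j
    using prim_j[OF that] by (simp add: image_primitive_def)
  have irr: "Divisibility.irreducible int_valued (Q (B j) (T j))" if j: "j < ?n" for j
  proof -
    obtain s where s: "s \<in> {1, -1}" "fs ! j = smult s (Q (B j) (T j))" using BT j by blast
    have "Divisibility.irreducible int_valued (fs ! j)" using fac j by (simp add: factors_def)
    then show ?thesis using irreducible_smult_sign carr_j[OF j] s by metis
  qed
  define Z N where "Z = {j. j < ?n \<and> T j = {}}" and "N = {j. j < ?n \<and> T j \<noteq> {}}"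
  have ZN: "{..<?n} = Z \<union> N" "Z \<inter> N = {}" unfolding Z_def N_def by blast+
  have fin: "finite Z" "finite N" unfolding Z_def N_def by simp_all
  \<comment> \<open>The sets \<open>T j\<close> partition the primes among the positions, so
    \<open>k\<close> determines \<open>j\<close> and the choice of covering depends on
    \<open>k\<close> alone.\<close>
  have "\<exists>J. \<forall>j<?n. k \<in> T j \<longrightarrow> minimal_covering (p k) g (B j) J" if "k \<in> K" for k
  proof -
    have "k \<in> (\<Union>j<?n. T j)" unfolding T(2) by (rule that)
    then obtain j where j: "j < ?n" "k \<in> T j" by blast
    then obtain J where J: "minimal_covering (p k) g (B j) J"
      using carr_j[OF j(1)] quot_in_carrier_iff[OF sub[OF j(1)]] by blast
    have "i = j" if "i < ?n" "k \<in> T i" for i using T_disj[of i j] that j by blast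
    then show ?thesis using J by blast
  qed
  then obtain J where J: "minimal_covering (p k) g (B j) (J k)" if "j < ?n" "k \<in> T j" "k \<in> K" for j k
    by metis
  have J_j: "minimal_covering (p k) g (B j) (J k)" if "j < ?n" "k \<in> T j" for j k
    using J[OF that] sub(2)[OF that(1)] that(2) by blast
  have cond: "irreducibility_conditions p g (B j) (T j)" if "j \<in> N" for j
    using irreducible_quot_iff[of "B j" "T j"] irr[of j] prim_j[of j] sub[of j] that by (auto simp: N_def)
  have U: "(\<Union>k\<in>T j. J k) = B j" if "j \<in> N" for j
  proof -
    have "minimal_coverings p g (B j) (T j) J"
      using J_j that by (simp add: minimal_coverings_def N_def)
    then show ?thesis using cond[OF that] unfolding irreducibility_conditions_def by metis
  qed
  let ?K = "T ` N"
  \<comment> \<open>Nonempty disjoint sets are distinct, so passing from positions to blocks loses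
    no multiplicity.\<close>
  have "inj_on T N" using T_disj by (force intro!: inj_onI simp: N_def)
  have adm: "admissible p g I K J ?K"
    unfolding admissible_def partitionable_by_def
  proof (intro conjI ballI)
    show "minimal_coverings p g I K J"
      unfolding minimal_coverings_def
    proof
      fix k assume "k \<in> K"
      then have "k \<in> (\<Union>j<?n. T j)" unfolding T(2) .
      then obtain j where j: "j < ?n" "k \<in> T j" by blast
      then have "J k \<subseteq> I" using minimal_covering_subset[OF J_j] sub(1) by blast
      then show "minimal_covering (p k) g I (J k)" using J_j[OF j] by (rule minimal_covering_mono[rotated])
    qed
    show "partition_on K ?K"
    proof (rule partition_onI)
      have "\<Union>(T ` N) = (\<Union>j<?n. T j)" by (auto simp: N_def)
      then show "\<Union>(T ` N) = K" using T(2) by simp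
    next
      fix X Y assume "X \<in> ?K" "Y \<in> ?K" "X \<noteq> Y"
      then show "disjnt X Y" using T_disj by (auto simp: N_def disjnt_def)
    qed (auto simp: N_def)
    show "disjoint_family_on (\<lambda>T. \<Union>k\<in>T. J k) ?K"
      unfolding disjoint_family_on_def
    proof (intro ballI impI)
      fix X Y assume "X \<in> ?K" "Y \<in> ?K" and "X \<noteq> Y"
      then obtain i j where ij: "i \<in> N" "j \<in> N" "X = T i" "Y = T j" "i \<noteq> j" by blast
      then show "(\<Union>k\<in>X. J k) \<inter> (\<Union>k\<in>Y. J k) = {}"
        using B_disj[of i j] U[OF ij(1)] U[OF ij(2)] by (simp add: N_def)
    qed
    show "irreducibility_conditions p g (\<Union>k\<in>X. J k) X" if "X \<in> ?K" for X
      using that cond U by auto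
  qed
  define fs' where "fs' = map (\<lambda>j. Q (B j) (T j)) [0..<?n]"
  have "\<exists>i. B j = {i}" if "j \<in> Z" for j
    using irreducible_quot_no_prime_iff[of "B j"] irr[of j] prim_j[of j] sub[of j] that by (auto simp: Z_def)
  then obtain \<iota> where \<iota>: "B j = {\<iota> j}" if "j \<in> Z" for j by metis
  have "inj_on \<iota> Z"
  proof (rule inj_onI, rule ccontr)
    fix i j assume "i \<in> Z" "j \<in> Z" "\<iota> i = \<iota> j" "i \<noteq> j"
    then show False using B_disj[of i j] \<iota>[of i] \<iota>[of j] by (auto simp: Z_def)
  qed
  \<comment> \<open>By \<open>U\<close>, the coverings use up exactly the \<open>B j\<close> with
    \<open>j\<close> in \<open>N\<close>; what remains are the singletons from
    \<open>Z\<close>.\<close>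
  have "uncovered I J ?K = (\<Union>j\<in>Z \<union> N. B j) - (\<Union>j\<in>N. B j)"
    using B(2) U by (simp add: uncovered_def ZN(1))
  also have "\<dots> = (\<Union>j\<in>Z. B j)"
  proof -
    have "B i \<inter> B j = {}" if "i \<in> Z" "j \<in> N" for i j
      using B_disj[of i j] that by (auto simp: Z_def N_def)
    then show ?thesis by blast
  qed
  also have "\<dots> = \<iota> ` Z" using \<iota> by auto
  finally have unc: "uncovered I J ?K = \<iota> ` Z" .
  have "mset fs' = image_mset (\<lambda>j. Q (B j) (T j)) (mset_set {..<?n})"
    by (simp add: fs'_def atLeast0LessThan)
  also have "\<dots> = image_mset (\<lambda>j. Q (B j) (T j)) (mset_set Z) + image_mset (\<lambda>j. Q (B j) (T j)) (mset_set N)"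
    using ZN fin by (simp add: mset_set_Union)
  also have "image_mset (\<lambda>j. Q (B j) (T j)) (mset_set Z) = image_mset (\<lambda>j. map_poly of_int (g (\<iota> j))) (mset_set Z)"
    using \<iota> fin(1) by (intro image_mset_cong) (simp add: quot_poly_def Z_def)
  also have "\<dots> = image_mset (\<lambda>i. map_poly of_int (g i)) (mset_set (\<iota> ` Z))"
    by (simp add: multiset.map_comp comp_def flip: image_mset_mset_set[OF \<open>inj_on \<iota> Z\<close>])
  also have "image_mset (\<lambda>j. Q (B j) (T j)) (mset_set N) =
      image_mset (\<lambda>X. Q (\<Union>k\<in>X. J k) X) (mset_set ?K)"
    unfolding image_mset_mset_set[OF \<open>inj_on T N\<close>, symmetric] multiset.map_comp
    using U fin(2) by (intro image_mset_cong) simp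
  finally have mset_fs': "mset fs' = associated_factors p g I J ?K"
    by (simp add: associated_factors_def unc)
  \<comment> \<open>\<open>fs'\<close> keeps the order of \<open>fs\<close>, so the entries differ
    only by signs and no reordering is involved.\<close>
  have "list_all2 (associated int_valued) fs fs'"
    unfolding list_all2_conv_all_nth
  proof (intro conjI allI impI)
    fix j assume j: "j < ?n"
    then obtain s where "s \<in> {1, -1}" "fs ! j = smult s (Q (B j) (T j))" using BT by blast
    then show "fs ! j \<sim>\<^bsub>int_valued\<^esub> fs' ! j"
      using smult_sign_associated[OF carr_j[OF j]] j by (simp add: fs'_def)
  qed (simp add: fs'_def)
  then have "essentially_equal int_valued fs fs'" unfolding essentially_equal_def by blast
  with adm mset_fs' show ?thesis by (rule that)
qed

end

section \<open>Exclusion of constant factors and assembly of both directions\<close>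

theorem corollary3p2:
  fixes I :: "'i set" and K :: "'k set"
    and g :: "'i \<Rightarrow> int poly" and p :: "'k \<Rightarrow> int" and f :: "rat poly"
  assumes "finite I" and "finite K"
    and "inj_on g I" and "\<And>i. i \<in> I \<Longrightarrow> Factorial_Ring.irreducible (g i)"
    and "inj_on p K" and "\<And>k. k \<in> K \<Longrightarrow> Factorial_Ring.prime (p k)"
    and "coprime (\<Prod>k\<in>K. p k) (content (\<Prod>i\<in>I. g i))"
    and f_eq: "f = smult (1 / of_int (\<Prod>k\<in>K. p k)) (map_poly of_int (\<Prod>i\<in>I. g i))"
    and "f \<in> carrier int_valued" and "image_primitive f"
  shows "(\<forall>J \<K>. admissible p g I K J \<K> \<longrightarrow>
            f = map_poly of_int (\<Prod>i\<in>uncovered I J \<K>. g i) *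
                (\<Prod>T\<in>\<K>. quot_poly p g (\<Union>k\<in>T. J k) T) \<and>
            (\<forall>fs. mset fs = associated_factors p g I J \<K> \<longrightarrow>
               set fs \<subseteq> carrier int_valued \<and> factors int_valued fs f \<and>
               length fs = card (uncovered I J \<K>) + card \<K>)) \<and>
         (\<forall>fs. set fs \<subseteq> carrier int_valued \<and> factors int_valued fs f \<longrightarrow>
            (\<exists>J \<K> fs'. admissible p g I K J \<K> \<and>
               mset fs' = associated_factors p g I J \<K> \<and>
               essentially_equal int_valued fs fs'))"
proof -
  \<comment> \<open>A constant \<open>g i\<close> would be coprime to \<open>\<Prod>k\<in>K. p k\<close> and hence divide the fixed divisor of \<open>f\<close>.\<close>
  have "degree (g i) > 0" if i: "i \<in> I" for i
  proof (rule ccontr)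
    assume "\<not> degree (g i) > 0"
    then obtain c where c: "g i = [:c:]" by (auto elim: degree_eq_zeroE)
    have dvd: "[:c:] dvd (\<Prod>i\<in>I. g i)" using i assms(1) c by (metis dvd_prodI)
    then have "c dvd content (\<Prod>i\<in>I. g i)" by (simp add: const_poly_dvd_iff_dvd_content)
    then have cop: "coprime c (\<Prod>k\<in>K. p k)" using assms(7) coprime_divisors coprime_commute by (metis dvd_refl)
    have pos: "(\<Prod>k\<in>K. p k) > 0" using assms(6) prime_gt_0_int by (intro prod_pos) blast
    have "\<exists>m. poly f (of_int n) = of_int (c * m)" for n
    proof -
      obtain k where k: "poly f (of_int n) = of_int k"
        using assms(9) by (metis int_valued_simps(1) Ints_cases)
      then have "of_int (poly (\<Prod>i\<in>I. g i) n) = (of_int ((\<Prod>k\<in>K. p k) * k) :: rat)"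
        using pos by (simp add: f_eq poly_map_poly_of_int field_simps del: of_int_prod)
      then have "poly (\<Prod>i\<in>I. g i) n = (\<Prod>k\<in>K. p k) * k" by (simp only: of_int_eq_iff)
      moreover have "c dvd poly (\<Prod>i\<in>I. g i) n" using dvd by (auto elim!: dvdE)
      ultimately have "c dvd k" using cop by (metis coprime_dvd_mult_right_iff)
      then show ?thesis using k by auto
    qed
    then have "is_unit c" by (rule image_primitive_imp_unit[OF assms(10)])
    then have "is_unit (g i)" by (simp add: c is_unit_const_poly_iff)
    then show False using assms(4)[OF i] by (simp add: Factorial_Ring.irreducible_def)
  qed
  then interpret irreducible_family I K g p
    using assms(1,2,4,5,6) by unfold_locales auto
  have f: "f = Q I K" by (simp add: f_eq quot_poly_def)
  have prim: "image_primitive (Q I K)" using assms(10) by (simp only: f)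
  show ?thesis
    unfolding f
  proof (rule conjI)
    show "\<forall>J \<K>. admissible p g I K J \<K> \<longrightarrow>
        Q I K = map_poly of_int (\<Prod>i\<in>uncovered I J \<K>. g i) * (\<Prod>T\<in>\<K>. Q (\<Union>k\<in>T. J k) T) \<and>
        (\<forall>fs. mset fs = associated_factors p g I J \<K> \<longrightarrow>
           set fs \<subseteq> carrier int_valued \<and> factors int_valued fs (Q I K) \<and>
           length fs = card (uncovered I J \<K>) + card \<K>)"
      by (intro allI impI conjI[OF admissible_imp_factors(1)] admissible_imp_factors(2) prim)
    show "\<forall>fs. set fs \<subseteq> carrier int_valued \<and> factors int_valued fs (Q I K) \<longrightarrow>
        (\<exists>J \<K> fs'. admissible p g I K J \<K> \<and> mset fs' = associated_factors p g I J \<K> \<and>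
           essentially_equal int_valued fs fs')"
    proof (intro allI impI, elim conjE)
      fix fs assume "set fs \<subseteq> carrier int_valued" "factors int_valued fs (Q I K)"
      from factors_imp_admissible[OF this prim]
      show "\<exists>J \<K> fs'. admissible p g I K J \<K> \<and> mset fs' = associated_factors p g I J \<K> \<and>
          essentially_equal int_valued fs fs'"
        by blast
    qed
  qed
qed

end
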